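(* Let $G=(V,A)$ be a routing graph with conditional fare network $\mathcal N=(\mathcal T,\Gamma,w,e,\mu,\pi)$, and let $C=(C_F,C_P,C_N)$ be its comparability partition. Then the relation $\leq_C$ on the set $F$ of fare states defined by this partition fulfills the monotonicity condition $$\forall f_1,f_2\in F:\quad f_1\leq_C f_2 \Longrightarrow \forall a\in A:\ \mathrm{Up}(f_1,a)\leq_C \mathrm{Up}(f_2,a).$$
   Context: All directed graphs are finite. A partially ordered positive monoid $(H,+,\leq)$ is a set $H$ with an associative operation $+$ and neutral element $\mathbf 0$, together with a partial order $\leq$ on $H$ such that $h_1\leq h_2\Rightarrow h_1+x\leq h_2+x$ for all $h_1,h_2,x\in H$, and $\mathbf 0\leq h$ for all $h\in H$. Let $G=(V,A)$ be a directed graph (the routing graph). A conditional fare network (CFN) $(\mathcal T,\Gamma,w,e,\mu,\pi)$ of $G$ consists of: (1) a finite directed acyclic graph $\mathcal T=(T,E)$ (the ticket graph; elements of $T$ are tickets) with a ticket transition function $\Gamma:T\times H\times S\to T$, where $(H,+,\leq)$ is a partially ordered positive monoid and $S$ is a set of fare events, such that $\Gamma(\tau,h,s)\in\delta^+(\tau)\cup\{\tau\}$ for all $\tau\in T,h\in H,s\in S$ ($\delta^+(\tau)$ is the set of out-neighbours of $\tau$ in $\mathcal T$); (2) arc weights $w:A\to H$; (3) arc events $e:A\to S$; (4) initial fare states $\mu:V\to F$, where $F:=T\times H$ is the set of fare states; (5) a price function $\pi:T\to\mathbb Q_{\geq 0}$ that is non-decreasing along directed paths of $\mathcal T$. For a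 fare state $f\in F$ write $f=(\tau(f),w(f))$ with $\tau(f)\in T$, $w(f)\in H$. The fare update function $\mathrm{Up}:F\times A\to F$ is given by $g=\mathrm{Up}(f,a)$ with $w(g)=w(f)+w(a)$ and $\tau(g)=\Gamma(\tau(f),w(g),e(a))$. For tickets write $\tau_1\rightarrow\tau_2$ if there is a directed path from $\tau_1$ to $\tau_2$ in $\mathcal T$ (including the case $\tau_1=\tau_2$). The reach $R(\tau)$ of $\tau\in T$ is the subgraph of $\mathcal T$ induced by $\{k\in T:\tau\rightarrow k\}$; $k\in R(\tau)$ means that $k$ is a vertex of $R(\tau)$. $R(\tau)$ is traceable if it contains a (directed) Hamiltonian path. $R(\tau)$ has the no-overtaking property if for all $k,l\in R(\tau)$ with $k\rightarrow l$ and all $(h,s)\in H\times S$ it holds that $$\forall \bar h\in H:\ h\leq\bar h\Longrightarrow \Gamma(k,h,s)\rightarrow\Gamma(l,\bar h,s).$$ The comparability partition $C=(C_F,C_P,C_N)$ of $T$ is $C_F:=\{\tau\in T: R(\tau)\text{ is traceable and has the no-overtaking property}\}$, $C_P:=\{\tau\in T\setminus C_F:\ \forall k\in R(\tau)\ \forall s\in S\ \forall h_1,h_2\in H:\ \Gamma(k,h_1,s)=\Gamma(k,h_2,s)\}$, $C_N:=T\setminus(C_F\cup C_P)$. For fare states $f_1=(\tau_1,h_1)$, $f_2=(\tau_2,h_2)$, define $f_1\leq_C f_2$ if and only if $\tau_1\notin C_N$, $h_1\leq h_2$, and: $\tau_1=\tau_2$ if $\tau_1\in C_P$; $\tau_1\rightarrow\tau_2$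 if $\tau_1\in C_F$. *)

theory Defs
  imports "Graph_Theory.Digraph_Component" "Graph_Theory.Arc_Walk"
begin

text \<open>The monoid is not assumed to be commutative, and the order is only assumed to be compatible
  with addition on the right, so \<open>ordered_ab_semigroup_add\<close> and its subclasses do not apply.\<close>

class partially_ordered_positive_monoid = monoid_add + order +
  assumes add_mono_right: "h1 \<le> h2 \<Longrightarrow> h1 + x \<le> h2 + x"
    and zero_least: "0 \<le> h"

type_synonym ('t, 'h) fare_state = "'t \<times> 'h"

text \<open>The routing graph has vertices of type \<open>'v\<close> and arcs of type \<open>'a\<close>, the ticket graph has
  tickets of type \<open>'t\<close> and arcs of type \<open>'e\<close>. The monoid is the whole type \<open>'h\<close>, whereas the
  fare events form a set, possibly empty, in the type \<open>'s\<close>.\<close>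

record ('v, 'a, 't, 'e, 'h, 's) fare_network =
  ticket_graph :: "('t, 'e) pre_digraph"
  fare_events :: "'s set"
  transition :: "'t \<Rightarrow> 'h \<Rightarrow> 's \<Rightarrow> 't"
  arc_weight :: "'a \<Rightarrow> 'h"
  arc_event :: "'a \<Rightarrow> 's"
  initial_state :: "'v \<Rightarrow> ('t, 'h) fare_state"
  price :: "'t \<Rightarrow> rat"

abbreviation tickets :: "('v, 'a, 't, 'e, 'h, 's) fare_network \<Rightarrow> 't set" where
  "tickets N \<equiv> verts (ticket_graph N)"

definition fare_states :: "('v, 'a, 't, 'e, 'h, 's) fare_network \<Rightarrow> ('t, 'h) fare_state set" where
  "fare_states N = tickets N \<times> UNIV"

locale conditional_fare_network =
  routing: fin_digraph G + ticket: fin_digraph "ticket_graph N"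
  for G :: "('v, 'a) pre_digraph"
    and N :: "('v, 'a, 't, 'e, 'h :: partially_ordered_positive_monoid, 's) fare_network" +
  assumes ticket_graph_acyclic: "acyclic (arcs_ends (ticket_graph N))"
    and transition_step:
      "\<lbrakk>\<tau> \<in> tickets N; s \<in> fare_events N\<rbrakk>
        \<Longrightarrow> transition N \<tau> h s \<in> {\<sigma>. \<tau> \<rightarrow>\<^bsub>ticket_graph N\<^esub> \<sigma>} \<union> {\<tau>}"
    and arc_event_in: "a \<in> arcs G \<Longrightarrow> arc_event N a \<in> fare_events N"
    and initial_state_in: "v \<in> verts G \<Longrightarrow> initial_state N v \<in> fare_states N"
    and price_nonneg: "\<tau> \<in> tickets N \<Longrightarrow> 0 \<le> price N \<tau>"
    and price_mono: "\<sigma> \<rightarrow>\<^sup>*\<^bsub>ticket_graph N\<^esub> \<tau> \<Longrightarrow> price N \<sigma> \<le> price N \<tau>"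

definition Up :: "('v, 'a, 't, 'e, 'h :: plus, 's) fare_network
    \<Rightarrow> ('t, 'h) fare_state \<Rightarrow> 'a \<Rightarrow> ('t, 'h) fare_state" where
  "Up N f a = (let h = snd f + arc_weight N a in (transition N (fst f) h (arc_event N a), h))"

definition reach :: "('v, 'a, 't, 'e, 'h, 's) fare_network \<Rightarrow> 't \<Rightarrow> ('t, 'e) pre_digraph" where
  "reach N \<tau> = ticket_graph N \<restriction> {k. \<tau> \<rightarrow>\<^sup>*\<^bsub>ticket_graph N\<^esub> k}"

definition traceable :: "('t, 'e) pre_digraph \<Rightarrow> bool" where
  "traceable D \<longleftrightarrow>
    (\<exists>u p v. pre_digraph.apath D u p v \<and> set (pre_digraph.awalk_verts D u p) = verts D)"

definition no_overtaking ::
  "('v, 'a, 't, 'e, 'h :: order, 's) fare_network \<Rightarrow> 't \<Rightarrow> bool" where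
  "no_overtaking N \<tau> \<longleftrightarrow>
    (\<forall>k \<in> verts (reach N \<tau>). \<forall>l \<in> verts (reach N \<tau>). k \<rightarrow>\<^sup>*\<^bsub>ticket_graph N\<^esub> l \<longrightarrow>
      (\<forall>h. \<forall>s \<in> fare_events N. \<forall>h'. h \<le> h' \<longrightarrow>
        transition N k h s \<rightarrow>\<^sup>*\<^bsub>ticket_graph N\<^esub> transition N l h' s))"

definition C_F :: "('v, 'a, 't, 'e, 'h :: order, 's) fare_network \<Rightarrow> 't set" where
  "C_F N = {\<tau> \<in> tickets N. traceable (reach N \<tau>) \<and> no_overtaking N \<tau>}"

definition C_P :: "('v, 'a, 't, 'e, 'h :: order, 's) fare_network \<Rightarrow> 't set" where
  "C_P N = {\<tau> \<in> tickets N - C_F N. \<forall>k \<in> verts (reach N \<tau>). \<forall>s \<in> fare_events N. \<forall>h1 h2.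
    transition N k h1 s = transition N k h2 s}"

definition C_N :: "('v, 'a, 't, 'e, 'h :: order, 's) fare_network \<Rightarrow> 't set" where
  "C_N N = tickets N - (C_F N \<union> C_P N)"

definition le_C :: "('v, 'a, 't, 'e, 'h :: order, 's) fare_network
    \<Rightarrow> ('t, 'h) fare_state \<Rightarrow> ('t, 'h) fare_state \<Rightarrow> bool" where
  "le_C N f1 f2 \<longleftrightarrow> f1 \<in> fare_states N \<and> f2 \<in> fare_states N \<and>
    fst f1 \<notin> C_N N \<and> snd f1 \<le> snd f2 \<and>
    (fst f1 \<in> C_P N \<longrightarrow> fst f1 = fst f2) \<and>
    (fst f1 \<in> C_F N \<longrightarrow> fst f1 \<rightarrow>\<^sup>*\<^bsub>ticket_graph N\<^esub> fst f2)"

end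

theory Submission
  imports Defs
begin

text \<open>
  Comparability of two fare states depends on the class of the smaller ticket, so monotonicity
  rests on the classes behaving well along the ticket graph: \<^const>\<open>C_F\<close> is closed under
  reachability (\<open>C_F_reachable\<close>), and a ticket outside \<^const>\<open>C_N\<close> never leads to one
  inside it (\<open>comparable_reachable\<close>). An update moves a ticket to itself or to an
  out-neighbour, so these facts apply to it. What remains is to compare the two new tickets.
  If the smaller ticket is in \<^const>\<open>C_P\<close>, both tickets agree and take the same transition,
  because it ignores the weight; equal tickets are comparable in either class. If the smaller
  ticket is in \<^const>\<open>C_F\<close>, it stays there, and no-overtaking provides the path between the two
  new tickets.

  The defining conditions of the two classes quantify over the reach of a ticket, which only
  shrinks along a path, so they are inherited. The one exception is traceability, which induced
  subgraphs do not inherit in general. Here acyclicity helps: on a Hamiltonian path of the reach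
  of \<open>\<tau>\<close>, all vertices before \<open>k\<close> have a path to \<open>k\<close> and hence are not reachable from it. The
  part from \<open>k\<close> on is therefore a Hamiltonian path of the reach of \<open>k\<close>
  (\<open>traceable_reachable_part\<close>).
\<close>

lemma (in wf_digraph) acyclic_reachable_antisym:
  assumes "acyclic (arcs_ends G)" "u \<rightarrow>\<^sup>* v" "v \<rightarrow>\<^sup>* u"
  shows "u = v"
  using assms by (meson acyclic_def reachable1_reachable_trans reachable_neq_reachable1)

text \<open>The final segment, starting at \<open>k\<close>, of a Hamiltonian path of the part reachable from
  \<open>\<tau>\<close> covers everything reachable from \<open>k\<close>: a vertex of the initial segment leads to \<open>k\<close>, so by
  acyclicity \<open>k\<close> leads to none of them except itself.\<close>

lemma (in wf_digraph) traceable_reachable_part: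
  assumes acyclic: "acyclic (arcs_ends G)"
    and trace: "traceable (G \<restriction> {l. \<tau> \<rightarrow>\<^sup>* l})"
    and "\<tau> \<rightarrow>\<^sup>* k"
  shows "traceable (G \<restriction> {l. k \<rightarrow>\<^sup>* l})"
proof -
  let ?R = "\<lambda>x. G \<restriction> {l. x \<rightarrow>\<^sup>* l}"
  note verts_eq = compatible_awalk_verts[OF compatible_induce_subgraph]
  from trace obtain u p v where R_path: "pre_digraph.apath (?R \<tau>) u p v"
    and cover: "set (awalk_verts u p) = {l. \<tau> \<rightarrow>\<^sup>* l}"
    by (auto simp: traceable_def verts_eq)
  have "subgraph (?R \<tau>) G"
    by (rule induced_imp_subgraph, rule induced_induce) (auto dest: reachable_in_verts)
  with R_path have path: "apath u p v"
    by (rule subgraph_apath_imp_apath)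
  with cover \<open>\<tau> \<rightarrow>\<^sup>* k\<close> obtain q r where p: "p = q @ r" and q: "awalk u q k" and r: "awalk k r v"
    using awalk_decomp[of u p v k] by (auto simp: apath_def)
  have r_cover: "set (awalk_verts k r) = {l. k \<rightarrow>\<^sup>* l}"
  proof (intro equalityI subsetI CollectI)
    fix l assume "l \<in> set (awalk_verts k r)"
    with r show "k \<rightarrow>\<^sup>* l" by (rule awalk_verts_reachable_from)
  next
    fix l assume "l \<in> {l. k \<rightarrow>\<^sup>* l}"
    hence kl: "k \<rightarrow>\<^sup>* l" by simp
    with \<open>\<tau> \<rightarrow>\<^sup>* k\<close> have "l \<in> set (awalk_verts u p)"
      using cover reachable_trans by blast
    hence "l \<in> set (awalk_verts u q) \<or> l \<in> set (awalk_verts k r)"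
      using set_awalk_verts_append[OF q r] p by auto
    thus "l \<in> set (awalk_verts k r)"
    proof
      assume "l \<in> set (awalk_verts u q)"
      with q have "l \<rightarrow>\<^sup>* k" by (rule awalk_verts_reachable_to)
      with acyclic kl have "l = k" by (blast dest: acyclic_reachable_antisym)
      thus ?thesis using r by (simp add: hd_in_awalk_verts)
    qed
  qed
  have "distinct (awalk_verts k r)"
    using path q unfolding p apath_append_iff by (auto simp: apath_def)
  moreover have "pre_digraph.awalk (?R k) k r v"
    using r awalk_verts_arc1[of _ r k] awalk_verts_arc2[OF r] r_cover
    by (auto simp: pre_digraph.awalk_def compatible_cas[OF compatible_induce_subgraph])
  ultimately have "pre_digraph.apath (?R k) k r v"
    by (simp add: pre_digraph.apath_def verts_eq)
  with r_cover show ?thesis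
    unfolding traceable_def by (metis verts_eq induce_subgraph_verts)
qed

lemma verts_reach: "verts (reach N \<tau>) = {k. \<tau> \<rightarrow>\<^sup>*\<^bsub>ticket_graph N\<^esub> k}"
  by (simp add: reach_def)

context conditional_fare_network
begin

lemma reach_antimono:
  "\<tau> \<rightarrow>\<^sup>*\<^bsub>ticket_graph N\<^esub> k \<Longrightarrow> verts (reach N k) \<subseteq> verts (reach N \<tau>)"
  by (auto simp: verts_reach intro: ticket.reachable_trans)

lemma transition_reachable:
  assumes "\<tau> \<in> tickets N" "s \<in> fare_events N"
  shows "\<tau> \<rightarrow>\<^sup>*\<^bsub>ticket_graph N\<^esub> transition N \<tau> h s"
  using transition_step[OF assms, of h] assms(1) by auto

lemma C_F_reachable:
  assumes "\<tau> \<in> C_F N" "\<tau> \<rightarrow>\<^sup>*\<^bsub>ticket_graph N\<^esub> k"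
  shows "k \<in> C_F N"
proof -
  have "traceable (reach N k)"
    using assms ticket.traceable_reachable_part[OF ticket_graph_acyclic]
    by (auto simp: C_F_def reach_def)
  moreover have "no_overtaking N k"
    using assms(1) reach_antimono[OF assms(2)] unfolding C_F_def no_overtaking_def by blast
  ultimately show ?thesis
    using assms(2) by (auto simp: C_F_def dest: ticket.reachable_in_verts)
qed

text \<open>A ticket of \<^const>\<open>C_P\<close> may lead to one of \<^const>\<open>C_F\<close>, since a smaller reach can become
  traceable or free of overtaking. Only the union of the two classes is closed.\<close>

lemma comparable_reachable:
  assumes "\<tau> \<in> tickets N" "\<tau> \<notin> C_N N" "\<tau> \<rightarrow>\<^sup>*\<^bsub>ticket_graph N\<^esub> k"
  shows "k \<notin> C_N N"
proof (cases "\<tau> \<in> C_F N")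
  case True
  with assms(3) have "k \<in> C_F N" by (rule C_F_reachable[rotated])
  thus ?thesis by (simp add: C_N_def)
next
  case False
  with assms(1,2) have "\<tau> \<in> C_P N" by (simp add: C_N_def)
  hence "k \<in> C_F N \<union> C_P N"
    using reach_antimono[OF assms(3)] ticket.reachable_in_verts(2)[OF assms(3)]
    unfolding C_P_def by blast
  thus ?thesis by (simp add: C_N_def)
qed

lemma Up_in_fare_states:
  assumes "f \<in> fare_states N" "a \<in> arcs G"
  shows "Up N f a \<in> fare_states N"
  using assms transition_reachable[OF _ arc_event_in]
  by (fastforce simp: fare_states_def Up_def Let_def dest: ticket.reachable_in_verts)

lemma Up_mono:
  assumes le: "le_C N f1 f2" and a: "a \<in> arcs G"
  shows "le_C N (Up N f1 a) (Up N f2 a)"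
proof -
  let ?s = "arc_event N a"
  obtain \<tau>1 h1 \<tau>2 h2 where f: "f1 = (\<tau>1, h1)" "f2 = (\<tau>2, h2)"
    by (metis surj_pair)
  define k1 where "k1 = h1 + arc_weight N a"
  define k2 where "k2 = h2 + arc_weight N a"
  define \<sigma>1 where "\<sigma>1 = transition N \<tau>1 k1 ?s"
  define \<sigma>2 where "\<sigma>2 = transition N \<tau>2 k2 ?s"
  have Up: "Up N f1 a = (\<sigma>1, k1)" "Up N f2 a = (\<sigma>2, k2)"
    by (simp_all add: f Up_def Let_def k1_def k2_def \<sigma>1_def \<sigma>2_def)
  have s: "?s \<in> fare_events N" using a by (rule arc_event_in)
  have states: "Up N f1 a \<in> fare_states N" "Up N f2 a \<in> fare_states N"
    using le a by (simp_all add: le_C_def Up_in_fare_states)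
  have \<tau>1: "\<tau>1 \<in> tickets N" "\<tau>1 \<notin> C_N N" and h: "h1 \<le> h2"
    using le by (auto simp: f le_C_def fare_states_def)
  have k: "k1 \<le> k2"
    unfolding k1_def k2_def using h by (rule add_mono_right)
  have step: "\<tau>1 \<rightarrow>\<^sup>*\<^bsub>ticket_graph N\<^esub> \<sigma>1"
    unfolding \<sigma>1_def using \<tau>1(1) s by (rule transition_reachable)
  have \<sigma>1: "\<sigma>1 \<notin> C_N N"
    using \<tau>1 step by (rule comparable_reachable)
  show ?thesis
  proof (cases "\<tau>1 \<in> C_F N")
    case True
    with le have "\<tau>1 \<rightarrow>\<^sup>*\<^bsub>ticket_graph N\<^esub> \<tau>2" by (simp add: f le_C_def)
    moreover have "no_overtaking N \<tau>1" using True by (simp add: C_F_def)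
    ultimately have "\<sigma>1 \<rightarrow>\<^sup>*\<^bsub>ticket_graph N\<^esub> \<sigma>2"
      using \<tau>1(1) s k unfolding \<sigma>1_def \<sigma>2_def no_overtaking_def verts_reach by auto
    moreover have "\<sigma>1 \<in> C_F N" using True step by (rule C_F_reachable)
    hence "\<sigma>1 \<notin> C_P N" by (simp add: C_P_def)
    ultimately show ?thesis
      using states \<sigma>1 k by (simp add: Up le_C_def)
  next
    case False
    with \<tau>1 have P: "\<tau>1 \<in> C_P N" by (simp add: C_N_def)
    with le have "\<tau>1 = \<tau>2" by (simp add: f le_C_def)
    moreover have "transition N \<tau>1 k1 ?s = transition N \<tau>1 k2 ?s"
      using P \<tau>1(1) s unfolding C_P_def verts_reach by blast
    ultimately have "\<sigma>1 = \<sigma>2" by (simp add: \<sigma>1_def \<sigma>2_def)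
    \<comment> \<open>As \<open>\<sigma>1\<close> may have passed from \<^const>\<open>C_P\<close> to \<^const>\<open>C_F\<close>, the trivial path is needed too.\<close>
    thus ?thesis
      using states \<sigma>1 k by (auto simp: Up le_C_def fare_states_def)
  qed
qed

end

theorem proposition4p2:
  fixes G :: "('v, 'a) pre_digraph"
    and N :: "('v, 'a, 't, 'e, 'h :: partially_ordered_positive_monoid, 's) fare_network"
  assumes "conditional_fare_network G N"
  shows "\<forall>f1 \<in> fare_states N. \<forall>f2 \<in> fare_states N.
    le_C N f1 f2 \<longrightarrow> (\<forall>a \<in> arcs G. le_C N (Up N f1 a) (Up N f2 a))"
  using conditional_fare_network.Up_mono[OF assms] by blast

end
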